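(* Let $\mathcal{P}$ be the set of all non-empty primitive interval orders (up to isomorphism), and define the formal power series \[ \mathbf{P}(t,v,w,x,y)=\sum_{P\in\mathcal{P}} t^{\mathrm{mag}(P)}x^{\mathrm{iso}(P)} y^{\min(P)} v^{\max(P)} w^{\mathrm{int}(P)}. \] For integers $n\ge 0$ let $V_n(a,b)=(a+1)(b+1)^n-1$. Then \[ \mathbf{P}(t,v,w,x,y) =\sum_{n\ge 0}t^{n+1}\frac{V_n(x,y)}{1+tV_n(v,w)}\prod_{i=0}^{n-1}\frac{V_i(v,w)}{1+tV_i(v,w)}. \]
   Context: All posets are finite and considered up to isomorphism. An interval order is a poset with no induced subposet isomorphic to the disjoint union of two 2-element chains. For an element $x$ of a poset $P$, its strict down-set is $D(x)=\{y\in P: y<x\}$ and its strict up-set is $U(x)=\{y\in P: y>x\}$; in an interval order the strict down-sets are totally ordered by inclusion. The magnitude $\mathrm{mag}(P)$ of an interval order $P$ is the number of distinct strict down-sets $D(x)$, $x\in P$. Two elements $x,y$ are indistinguishable if $D(x)=D(y)$ and $U(x)=U(y)$; $P$ is primitive if no two distinct elements are indistinguishable. An element is isolated if it is comparable to no other element, and internal if it is neither minimal nor maximal. The statistics are: $\mathrm{iso}(P)$ = number of isolated elements; $\min(P)$ = number of non-isolated minimal elements; $\max(P)$ = number of non-isolated maximal elements; $\mathrm{int}(P)$ = number of internal elements. The identity is an identity of formal power series (the right-hand side converges in the formal topology). *)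

theory Defs
  imports "HOL-Analysis.Analysis" "HOL-Computational_Algebra.Formal_Power_Series"
begin

text \<open>
  A finite poset is given by its reflexive order relation \<open>r\<close>, with \<open>(x, y) \<in> r\<close> meaning
  \<open>x \<le> y\<close>; the ground set is \<open>Field r\<close>. The strict down-set and the strict up-set of \<open>x\<close>
  are \<open>underS r x\<close> and \<open>aboveS r x\<close>.
\<close>

definition finite_poset :: "'a rel \<Rightarrow> bool" where
  "finite_poset r \<longleftrightarrow> finite (Field r) \<and> Partial_order r"

definition poset_isomorphic :: "'a rel \<Rightarrow> 'b rel \<Rightarrow> bool" where
  "poset_isomorphic r s \<longleftrightarrow>
     (\<exists>f. bij_betw f (Field r) (Field s) \<and>
          (\<forall>x\<in>Field r. \<forall>y\<in>Field r. (x, y) \<in> r \<longleftrightarrow> (f x, f y) \<in> s))"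

definition two_plus_two :: "nat rel" where
  "two_plus_two = {(0,0), (1,1), (2,2), (3,3), (0,1), (2,3)}"

definition interval_order :: "'a rel \<Rightarrow> bool" where
  "interval_order r \<longleftrightarrow>
     finite_poset r \<and> \<not> (\<exists>A\<subseteq>Field r. poset_isomorphic (Restr r A) two_plus_two)"

definition indistinguishable :: "'a rel \<Rightarrow> 'a \<Rightarrow> 'a \<Rightarrow> bool" where
  "indistinguishable r x y \<longleftrightarrow> underS r x = underS r y \<and> aboveS r x = aboveS r y"

definition primitive :: "'a rel \<Rightarrow> bool" where
  "primitive r \<longleftrightarrow>
     \<not> (\<exists>x\<in>Field r. \<exists>y\<in>Field r. x \<noteq> y \<and> indistinguishable r x y)"

definition isolated :: "'a rel \<Rightarrow> 'a \<Rightarrow> bool" where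
  "isolated r x \<longleftrightarrow> (\<forall>y\<in>Field r. y \<noteq> x \<longrightarrow> (x, y) \<notin> r \<and> (y, x) \<notin> r)"

definition minimal :: "'a rel \<Rightarrow> 'a \<Rightarrow> bool" where
  "minimal r x \<longleftrightarrow> \<not> (\<exists>y\<in>Field r. y \<noteq> x \<and> (y, x) \<in> r)"

definition maximal :: "'a rel \<Rightarrow> 'a \<Rightarrow> bool" where
  "maximal r x \<longleftrightarrow> \<not> (\<exists>y\<in>Field r. y \<noteq> x \<and> (x, y) \<in> r)"

definition mag :: "'a rel \<Rightarrow> nat" where
  "mag r = card (underS r ` Field r)"

definition num_iso :: "'a rel \<Rightarrow> nat" where
  "num_iso r = card {x \<in> Field r. isolated r x}"

definition num_min :: "'a rel \<Rightarrow> nat" where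
  "num_min r = card {x \<in> Field r. minimal r x \<and> \<not> isolated r x}"

definition num_max :: "'a rel \<Rightarrow> nat" where
  "num_max r = card {x \<in> Field r. maximal r x \<and> \<not> isolated r x}"

definition num_int :: "'a rel \<Rightarrow> nat" where
  "num_int r = card {x \<in> Field r. \<not> minimal r x \<and> \<not> maximal r x}"

text \<open>
  Every finite poset is isomorphic to one whose ground set consists of natural numbers, so the
  isomorphism classes are taken among relations on \<open>nat\<close>.
\<close>

definition iso_rel :: "nat rel rel" where
  "iso_rel = {(r, s). finite_poset r \<and> finite_poset s \<and> poset_isomorphic r s}"

definition primitive_interval_orders :: "nat rel set set" where
  "primitive_interval_orders =
     {r. Field r \<noteq> {} \<and> interval_order r \<and> primitive r} // iso_rel"

text \<open>
  Power series in five variables are iterated univariate power series, with \<open>t\<close> the outermost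
  variable. The library topology on this type is the \<open>t\<close>-adic one, in which convergence means that
  the coefficient of every power of \<open>t\<close>, a series in \<open>v, w, x, y\<close>, is eventually constant. The
  rational coefficients provide the library's division; \<open>a / b\<close> is the quotient of power series
  whenever \<open>b\<close> has \<open>t\<close>-constant term 1 (see \<open>divide_mult_cancel_unit\<close> below).
\<close>

type_synonym series = "rat fps fps fps fps fps"

definition var_t :: series where "var_t = fps_X"
definition var_v :: series where "var_v = fps_const fps_X"
definition var_w :: series where "var_w = fps_const (fps_const fps_X)"
definition var_x :: series where "var_x = fps_const (fps_const (fps_const fps_X))"
definition var_y :: series where "var_y = fps_const (fps_const (fps_const (fps_const fps_X)))"

definition weight :: "'a rel \<Rightarrow> series" where
  "weight r = var_t ^ mag r * var_x ^ num_iso r * var_y ^ num_min r *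
              var_v ^ num_max r * var_w ^ num_int r"

definition class_weight :: "nat rel set \<Rightarrow> series" where
  "class_weight C = the_elem (weight ` C)"

definition P_series :: series where
  "P_series = (\<Sum>\<^sub>\<infinity>C\<in>primitive_interval_orders. class_weight C)"

definition V :: "nat \<Rightarrow> series \<Rightarrow> series \<Rightarrow> series" where
  "V n a b = (a + 1) * (b + 1) ^ n - 1"

lemma divide_mult_cancel_unit:
  fixes a b :: series
  assumes "fps_nth b 0 = 1"
  shows "(a / b) * b = a"
proof -
  have inv1: "inverse (1 :: rat fps fps fps fps) = 1"
    by (simp add: fps_inverse_one')
  have nz: "b \<noteq> 0" using assms by auto
  have "subdegree b = 0" using assms by (simp add: subdegree_eq_0)
  hence "a / b = a * inverse b" using nz by (simp add: fps_divide_def)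
  moreover have "inverse b * b = 1"
    using fps_left_inverse'[of 1 b "inverse (fps_nth b 0)"] assms inv1
    by (simp add: fps_inverse_def[of b])
  ultimately show ?thesis by (simp add: mult.assoc)
qed

lemma equiv_iso_rel: "equiv {r. finite_poset r} iso_rel"
proof (rule equivI)
  show "iso_rel \<subseteq> {r. finite_poset r} \<times> {r. finite_poset r}"
    by (auto simp: iso_rel_def)
  show "refl_on {r. finite_poset r} iso_rel"
    by (auto simp: refl_on_def iso_rel_def poset_isomorphic_def intro: exI[of _ id])
  show "sym iso_rel"
  proof (rule symI)
    fix r s assume a: "(r, s) \<in> iso_rel"
    then obtain f where f: "bij_betw f (Field r) (Field s)"
      "\<forall>x\<in>Field r. \<forall>y\<in>Field r. (x, y) \<in> r \<longleftrightarrow> (f x, f y) \<in> s"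
      by (auto simp: iso_rel_def poset_isomorphic_def)
    let ?g = "inv_into (Field r) f"
    have "bij_betw ?g (Field s) (Field r)" by (rule bij_betw_inv_into[OF f(1)])
    moreover have "(x, y) \<in> s \<longleftrightarrow> (?g x, ?g y) \<in> r" if "x \<in> Field s" "y \<in> Field s" for x y
      using f(2) that bij_betw_inv_into_right[OF f(1)]
        bij_betwE[OF \<open>bij_betw ?g (Field s) (Field r)\<close>] by simp
    ultimately show "(s, r) \<in> iso_rel"
      using a unfolding iso_rel_def poset_isomorphic_def by blast
  qed
  show "trans iso_rel"
  proof (rule transI)
    fix r s u assume a: "(r, s) \<in> iso_rel" "(s, u) \<in> iso_rel"
    then obtain f g where fg: "bij_betw f (Field r) (Field s)"
      "\<forall>x\<in>Field r. \<forall>y\<in>Field r. (x, y) \<in> r \<longleftrightarrow> (f x, f y) \<in> s"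
      "bij_betw g (Field s) (Field u)"
      "\<forall>x\<in>Field s. \<forall>y\<in>Field s. (x, y) \<in> s \<longleftrightarrow> (g x, g y) \<in> u"
      by (auto simp: iso_rel_def poset_isomorphic_def)
    have "bij_betw (g \<circ> f) (Field r) (Field u)" using fg(1,3) by (rule bij_betw_trans)
    moreover have "\<forall>x\<in>Field r. \<forall>y\<in>Field r. (x, y) \<in> r \<longleftrightarrow> ((g \<circ> f) x, (g \<circ> f) y) \<in> u"
      using fg(2,4) bij_betwE[OF fg(1)] by simp
    ultimately show "(r, u) \<in> iso_rel"
      using a unfolding iso_rel_def poset_isomorphic_def by blast
  qed
qed

lemma weight_cong_iso:
  assumes "poset_isomorphic r s"
  shows "weight r = weight s"
proof -
  obtain f where f: "bij_betw f (Field r) (Field s)"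
    and fr: "\<And>x y. x \<in> Field r \<Longrightarrow> y \<in> Field r \<Longrightarrow> (x, y) \<in> r \<longleftrightarrow> (f x, f y) \<in> s"
    using assms by (auto simp: poset_isomorphic_def)
  have im: "f ` Field r = Field s" and inj: "inj_on f (Field r)"
    using f by (auto simp: bij_betw_def)
  have eq: "f x = f y \<longleftrightarrow> x = y" if "x \<in> Field r" "y \<in> Field r" for x y
    using inj that by (auto dest: inj_onD)
  have card_eq: "card {x \<in> Field r. Q x} = card {x \<in> Field s. Q' x}"
    if "\<And>x. x \<in> Field r \<Longrightarrow> Q x \<longleftrightarrow> Q' (f x)" for Q Q'
  proof -
    have "{x \<in> Field s. Q' x} = f ` {x \<in> Field r. Q x}"
      using that by (auto simp flip: im)
    moreover have "inj_on f {x \<in> Field r. Q x}" using inj by (rule inj_on_subset) auto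
    ultimately show ?thesis by (simp add: card_image)
  qed
  have isol: "isolated r x \<longleftrightarrow> isolated s (f x)" if "x \<in> Field r" for x
    using that by (auto simp: isolated_def fr eq simp flip: im)
  have mini: "minimal r x \<longleftrightarrow> minimal s (f x)" if "x \<in> Field r" for x
    using that by (auto simp: minimal_def fr eq simp flip: im)
  have maxi: "maximal r x \<longleftrightarrow> maximal s (f x)" if "x \<in> Field r" for x
    using that by (auto simp: maximal_def fr eq simp flip: im)
  have under: "underS s (f x) = f ` underS r x" if x: "x \<in> Field r" for x
  proof (intro equalityI subsetI)
    fix z assume z: "z \<in> underS s (f x)"
    hence "z \<in> Field s" by (auto simp: underS_def Field_def)
    then obtain y where "y \<in> Field r" "z = f y" using im by auto
    with z x show "z \<in> f ` underS r x" by (auto simp: underS_def fr eq)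
  next
    fix z assume "z \<in> f ` underS r x"
    then obtain y where y: "y \<in> underS r x" "z = f y" by auto
    hence "y \<in> Field r" by (auto simp: underS_def Field_def)
    with y x show "z \<in> underS s (f x)" by (auto simp: underS_def fr eq)
  qed
  have "underS s ` Field s = image f ` (underS r ` Field r)"
    by (simp add: image_image under flip: im)
  moreover have "inj_on (image f) (underS r ` Field r)"
  proof (rule inj_on_subset[OF inj_on_image_Pow[OF inj]])
    show "underS r ` Field r \<subseteq> Pow (Field r)" by (auto simp: underS_def Field_def)
  qed
  ultimately have "mag r = mag s" by (simp add: mag_def card_image)
  moreover have "num_iso r = num_iso s"
    unfolding num_iso_def by (intro card_eq isol)
  moreover have "num_min r = num_min s"
    unfolding num_min_def by (intro card_eq) (simp add: isol mini)
  moreover have "num_max r = num_max s"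
    unfolding num_max_def by (intro card_eq) (simp add: isol maxi)
  moreover have "num_int r = num_int s"
    unfolding num_int_def by (intro card_eq) (simp add: mini maxi)
  ultimately show ?thesis by (simp add: weight_def)
qed

lemma class_weight_eq:
  assumes "finite_poset r"
  shows "class_weight (iso_rel `` {r}) = weight r"
proof -
  have "r \<in> iso_rel `` {r}"
    using equiv_class_self[OF equiv_iso_rel] assms by simp
  moreover have "weight s = weight r" if "s \<in> iso_rel `` {r}" for s
    using that weight_cong_iso[of r s] by (simp add: iso_rel_def)
  ultimately have "weight ` (iso_rel `` {r}) = {weight r}"
    by blast
  thus ?thesis by (simp add: class_weight_def)
qed

end

theory Submission
  imports Defs "HOL-Library.Nat_Bijection"
begin

text \<open>
  Numbering the distinct strict down-sets of an interval order \<open>0, \<dots>, m - 1\<close> by inclusion, send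
  \<open>x\<close> to \<open>(i, j)\<close>, where \<open>i\<close> is the number of \<open>D(x)\<close> and \<open>j\<close> counts the down-sets not containing
  \<open>x\<close>; then \<open>x < y\<close> iff the \<open>j\<close> of \<open>x\<close> is at most the \<open>i\<close> of \<open>y\<close>. This identifies the primitive
  interval orders of magnitude \<open>m\<close> with the sets of cells \<open>(i, j)\<close>, \<open>0 \<le> i < j \<le> m\<close>, that meet
  every row and every column; minimal elements lie in row \<open>0\<close>, maximal ones in column \<open>m\<close>.

  By inclusion-exclusion over the columns, the generating polynomial of these sets is a signed
  sum over column sets \<open>T\<close>, in which a row with \<open>k + 1\<close> available columns contributes \<open>V\<^sub>k(v, w)\<close>,
  or \<open>V\<^sub>k(x, y)\<close> for row \<open>0\<close>. Reading the rows from the last to the first, \<open>k\<close> starts at \<open>0\<close>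
  and each further row either increments it or, with a factor \<open>-1\<close>, keeps it. Collecting
  the rows at each level \<open>k\<close> into a geometric series gives the product formula.
\<close>

section \<open>Interval representations\<close>

text \<open>Element \<open>x\<close> is represented by the half-open interval from \<open>b x\<close> to \<open>e x\<close>.\<close>

definition interval_rep :: "'a rel \<Rightarrow> nat \<Rightarrow> ('a \<Rightarrow> nat) \<Rightarrow> ('a \<Rightarrow> nat) \<Rightarrow> bool" where
  "interval_rep r m b e \<longleftrightarrow>
     (\<forall>x\<in>Field r. b x < e x) \<and>
     (\<forall>x\<in>Field r. \<forall>y\<in>Field r. (x, y) \<in> r \<longleftrightarrow> x = y \<or> e x \<le> b y) \<and>
     b ` Field r = {..<m} \<and> e ` Field r = {1..m}"

text \<open>Both ends are computed from the family of strict down-sets alone, so they can serve as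
  the reference with which every other representation is compared.\<close>

definition left_end :: "'a rel \<Rightarrow> 'a \<Rightarrow> nat" where
  "left_end r x = card {D \<in> underS r ` Field r. D \<subset> underS r x}"

definition right_end :: "'a rel \<Rightarrow> 'a \<Rightarrow> nat" where
  "right_end r x = card {D \<in> underS r ` Field r. x \<notin> D}"

lemma interval_repD:
  assumes "interval_rep r m b e"
  shows "\<And>x. x \<in> Field r \<Longrightarrow> b x < e x"
    and "\<And>x. x \<in> Field r \<Longrightarrow> e x \<le> m"
    and "\<And>x y. x \<in> Field r \<Longrightarrow> y \<in> Field r \<Longrightarrow> (x, y) \<in> r \<longleftrightarrow> x = y \<or> e x \<le> b y"
    and "\<And>k. k < m \<Longrightarrow> \<exists>x\<in>Field r. b x = k"
    and "\<And>k. 0 < k \<Longrightarrow> k \<le> m \<Longrightarrow> \<exists>x\<in>Field r. e x = k"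
proof -
  have A1: "\<forall>x\<in>Field r. b x < e x"
    and A2: "\<forall>x\<in>Field r. \<forall>y\<in>Field r. (x, y) \<in> r \<longleftrightarrow> x = y \<or> e x \<le> b y"
    and A3: "b ` Field r = {..<m}" and A4: "e ` Field r = {1..m}"
    using assms unfolding interval_rep_def by simp_all
  show "x \<in> Field r \<Longrightarrow> b x < e x" for x using A1 by simp
  show "x \<in> Field r \<Longrightarrow> e x \<le> m" for x using A4 by (metis atLeastAtMost_iff imageI)
  show "x \<in> Field r \<Longrightarrow> y \<in> Field r \<Longrightarrow> (x, y) \<in> r \<longleftrightarrow> x = y \<or> e x \<le> b y" for x y
    using A2 by simp
  show "\<exists>x\<in>Field r. b x = k" if "k < m" for k
    using A3 that by (metis imageE lessThan_iff)
  show "\<exists>x\<in>Field r. e x = k" if "0 < k" "k \<le> m" for k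
  proof -
    have "k \<in> e ` Field r" unfolding A4 using that by simp
    thus ?thesis by blast
  qed
qed

lemma interval_rep_underS:
  assumes rep: "interval_rep r m b e" and x: "x \<in> Field r"
  shows "underS r x = {y \<in> Field r. e y \<le> b x}"
  using interval_repD(1)[OF rep x] interval_repD(3)[OF rep _ x] unfolding underS_def
  by (auto intro: FieldI1)

text \<open>The strict down-set of \<open>x\<close> is \<open>W (b x)\<close>. As \<open>e\<close>
  attains every value from \<open>1\<close> to \<open>m\<close>, the sets
  \<open>W 0, ..., W (m - 1)\<close> increase strictly. Hence they are the \<open>m\<close> distinct
  down-sets, \<open>b x\<close> is the rank of the one of \<open>x\<close>, and \<open>x\<close> is
  missing from exactly the first \<open>e x\<close> of them.\<close>

lemma interval_rep_unique:
  assumes rep: "interval_rep r m b e"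
  shows "mag r = m"
    and "\<And>x. x \<in> Field r \<Longrightarrow> left_end r x = b x"
    and "\<And>x. x \<in> Field r \<Longrightarrow> right_end r x = e x"
proof -
  note R = interval_repD[OF rep]
  define W where "W k = {y \<in> Field r. e y \<le> k}" for k
  have W_less: "W k \<subset> W l" if kl: "k < l" "l < m" for k l
  proof -
    obtain y where "y \<in> Field r" "e y = l" using R(5)[of l] kl by auto
    hence "y \<in> W l - W k" "W k \<subseteq> W l" using kl by (auto simp: W_def)
    thus ?thesis by blast
  qed
  have W_less_iff: "W k \<subset> W l \<longleftrightarrow> k < l" if "k < m" "l < m" for k l
    using W_less[of k l] W_less[of l k] that by (cases k l rule: linorder_cases) auto
  have inj: "inj_on W {..<m}"
    by (rule inj_onI) (metis W_less_iff lessThan_iff linorder_neqE_nat psubsetE order_refl)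
  have under: "underS r x = W (b x)" if "x \<in> Field r" for x
    using interval_rep_underS[OF rep that] by (simp add: W_def)
  have "b ` Field r = {..<m}" using rep by (simp add: interval_rep_def)
  hence downsets: "underS r ` Field r = W ` {..<m}"
    by (metis (no_types, lifting) image_cong image_image under)
  show "mag r = m"
    by (simp add: mag_def downsets card_image[OF inj])
  have card_W: "card {D \<in> W ` {..<m}. Q D} = n"
    if "n \<le> m" "\<And>k. k < m \<Longrightarrow> Q (W k) \<longleftrightarrow> k < n" for Q n
  proof -
    have "{D \<in> W ` {..<m}. Q D} = W ` {..<n}" using that by force
    moreover have "inj_on W {..<n}" using inj by (rule inj_on_subset) (use that in auto)
    ultimately show ?thesis by (simp add: card_image)
  qed
  show "left_end r x = b x" if x: "x \<in> Field r" for x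
  proof -
    have "b x < m" using R(1,2)[OF x] by simp
    thus ?thesis unfolding left_end_def downsets under[OF x]
      by (intro card_W) (simp_all add: W_less_iff)
  qed
  show "right_end r x = e x" if x: "x \<in> Field r" for x
    unfolding right_end_def downsets
    by (intro card_W) (use R(2)[OF x] x in \<open>auto simp: W_def\<close>)
qed

section \<open>Statistics and primitivity read off the endpoints\<close>

lemma minimal_interval_rep:
  assumes rep: "interval_rep r m b e" and x: "x \<in> Field r"
  shows "minimal r x \<longleftrightarrow> b x = 0"
proof
  note R = interval_repD[OF rep]
  show "minimal r x" if "b x = 0"
    unfolding minimal_def using R(1,3) x that by (metis le_zero_eq not_less_zero)
  show "b x = 0" if "minimal r x"
  proof (rule ccontr)
    assume "b x \<noteq> 0"
    \<comment> \<open>Surjectivity of \<open>e\<close> supplies an interval ending where that of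
      \<open>x\<close> begins; its element lies below \<open>x\<close>.\<close>
    then obtain y where "y \<in> Field r" "e y = b x"
      using R(5)[of "b x"] R(1,2)[OF x] by auto
    thus False using that R(1,3) x unfolding minimal_def by (metis less_irrefl order_refl)
  qed
qed

lemma maximal_interval_rep:
  assumes rep: "interval_rep r m b e" and x: "x \<in> Field r"
  shows "maximal r x \<longleftrightarrow> e x = m"
proof
  note R = interval_repD[OF rep]
  show "maximal r x" if "e x = m"
    unfolding maximal_def using R(1,2,3) x that by (metis leD order.strict_trans2)
  show "e x = m" if "maximal r x"
  proof (rule ccontr)
    assume "e x \<noteq> m"
    then obtain y where "y \<in> Field r" "b y = e x"
      using R(4)[of "e x"] R(1,2)[OF x] by auto
    thus False using that R(1,3) x unfolding maximal_def by (metis less_irrefl order_refl)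
  qed
qed

lemma isolated_iff_minimal_maximal:
  "isolated r x \<longleftrightarrow> minimal r x \<and> maximal r x"
  by (auto simp: isolated_def minimal_def maximal_def)

text \<open>The corner \<open>(0, m)\<close> belongs to elements both minimal and maximal, that is,
  isolated; hence it carries neither \<open>var_y\<close> nor \<open>var_v\<close>.\<close>

definition cell_weight :: "nat \<Rightarrow> nat \<times> nat \<Rightarrow> series" where
  "cell_weight m p =
     (if fst p = 0 then if snd p = m then var_x else var_y
      else if snd p = m then var_v else var_w)"

lemma weight_interval_rep:
  assumes rep: "interval_rep r m b e" and fin: "finite (Field r)"
  shows "weight r = var_t ^ m * (\<Prod>x\<in>Field r. cell_weight m (b x, e x))"
proof -
  let ?F = "Field r"
  have I: "num_iso r = card {x \<in> ?F. b x = 0 \<and> e x = m}"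
    "num_min r = card {x \<in> ?F. b x = 0 \<and> e x \<noteq> m}"
    "num_max r = card {x \<in> ?F. b x \<noteq> 0 \<and> e x = m}"
    "num_int r = card {x \<in> ?F. b x \<noteq> 0 \<and> e x \<noteq> m}"
    unfolding num_iso_def num_min_def num_max_def num_int_def isolated_iff_minimal_maximal
    using minimal_interval_rep[OF rep] maximal_interval_rep[OF rep]
    by (auto intro!: arg_cong[where f = card])
  have "(\<Prod>x\<in>?F. cell_weight m (b x, e x)) =
    var_x ^ card (?F \<inter> {x. b x = 0} \<inter> {x. e x = m}) *
    var_y ^ card (?F \<inter> {x. b x = 0} \<inter> - {x. e x = m}) *
    (var_v ^ card (?F \<inter> - {x. b x = 0} \<inter> {x. e x = m}) *
    var_w ^ card (?F \<inter> - {x. b x = 0} \<inter> - {x. e x = m}))"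
    using fin by (simp add: cell_weight_def prod.If_cases)
  also have "?F \<inter> {x. b x = 0} \<inter> {x. e x = m} = {x \<in> ?F. b x = 0 \<and> e x = m}" by auto
  also have "?F \<inter> {x. b x = 0} \<inter> - {x. e x = m} = {x \<in> ?F. b x = 0 \<and> e x \<noteq> m}" by auto
  also have "?F \<inter> - {x. b x = 0} \<inter> {x. e x = m} = {x \<in> ?F. b x \<noteq> 0 \<and> e x = m}" by auto
  also have "?F \<inter> - {x. b x = 0} \<inter> - {x. e x = m} = {x \<in> ?F. b x \<noteq> 0 \<and> e x \<noteq> m}" by auto
  finally show ?thesis
    unfolding weight_def by (simp add: interval_rep_unique(1)[OF rep] I mult_ac)
qed

text \<open>The left end depends only on the strict down-set. The right end depends only on the
  strict up-set, because \<open>x\<close> lies in the down-set of \<open>z\<close> exactly when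
  \<open>z\<close> lies in the up-set of \<open>x\<close>. Conversely, the ends determine both
  sets.\<close>

lemma primitive_interval_rep:
  assumes rep: "interval_rep r m b e"
  shows "primitive r \<longleftrightarrow> inj_on (\<lambda>x. (b x, e x)) (Field r)"
proof -
  note R = interval_repD[OF rep]
  have up: "aboveS r x = {y \<in> Field r. e x \<le> b y}" if "x \<in> Field r" for x
    using R(1)[OF that] R(3)[OF that] that unfolding aboveS_def by (auto intro: FieldI2)
  have "indistinguishable r x y \<longleftrightarrow> b x = b y \<and> e x = e y"
    if xy: "x \<in> Field r" "y \<in> Field r" for x y
  proof
    assume ind: "indistinguishable r x y"
    have "b x = b y"
      using ind interval_rep_unique(2)[OF rep xy(1)] interval_rep_unique(2)[OF rep xy(2)]
      by (simp add: indistinguishable_def left_end_def)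
    moreover have "e x = e y"
    proof -
      have "{D \<in> underS r ` Field r. x \<notin> D} = {D \<in> underS r ` Field r. y \<notin> D}"
        using ind unfolding indistinguishable_def underS_def aboveS_def by auto
      thus ?thesis
        using interval_rep_unique(3)[OF rep xy(1)] interval_rep_unique(3)[OF rep xy(2)]
        by (simp add: right_end_def)
    qed
    ultimately show "b x = b y \<and> e x = e y" by simp
  next
    assume "b x = b y \<and> e x = e y"
    thus "indistinguishable r x y"
      using xy by (simp add: indistinguishable_def interval_rep_underS[OF rep] up)
  qed
  thus ?thesis unfolding primitive_def inj_on_def by fastforce
qed

section \<open>Interval orders as the orders with an interval representation\<close>

lemma interval_order_interval_rep:
  assumes rep: "interval_rep r m b e" and fin: "finite (Field r)"
  shows "interval_order r"
proof -
  note R = interval_repD[OF rep]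
  have "(x, x) \<in> r" if "x \<in> Field r" for x using R(3) that by blast
  moreover have "r \<subseteq> Field r \<times> Field r" by (auto intro: FieldI1 FieldI2)
  moreover have "trans r"
  proof (rule transI)
    fix x y z assume xyz: "(x, y) \<in> r" "(y, z) \<in> r"
    hence "x \<in> Field r" "y \<in> Field r" "z \<in> Field r" by (auto intro: FieldI1 FieldI2)
    thus "(x, z) \<in> r" using xyz R(1)[of y] R(3) by (metis order.strict_implies_order order.trans)
  qed
  moreover have "antisym r"
  proof (rule antisymI)
    fix x y assume xy: "(x, y) \<in> r" "(y, x) \<in> r"
    hence "x \<in> Field r" "y \<in> Field r" by (auto intro: FieldI1 FieldI2)
    thus "x = y" using xy R(1)[of x] R(1)[of y] R(3)[of x y] R(3)[of y x] by auto
  qed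
  ultimately have "finite_poset r"
    using fin by (auto simp: finite_poset_def partial_order_on_def preorder_on_def refl_on_def)
  moreover have False if A: "A \<subseteq> Field r" "poset_isomorphic (Restr r A) two_plus_two" for A
  proof -
    have FA: "Field (Restr r A) = A"
      using A(1) \<open>\<And>x. x \<in> Field r \<Longrightarrow> (x, x) \<in> r\<close> by (fastforce simp: Field_def)
    have FT: "Field two_plus_two = {0,1,2,3}" by (auto simp: two_plus_two_def Field_def)
    from A(2) obtain f where f: "bij_betw f A {0,1,2,3}"
      and fr: "\<And>x y. x \<in> A \<Longrightarrow> y \<in> A \<Longrightarrow> (x, y) \<in> r \<longleftrightarrow> (f x, f y) \<in> two_plus_two"
      unfolding poset_isomorphic_def FA FT by auto
    have ex: "\<exists>x\<in>A. f x = k" if "k \<in> {0,1,2,3}" for k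
      using f that unfolding bij_betw_def by (metis imageE)
    obtain p q s u where "p \<in> A" "f p = 0" "q \<in> A" "f q = 1" "s \<in> A" "f s = 2" "u \<in> A" "f u = 3"
      using ex[of 0] ex[of 1] ex[of 2] ex[of 3] by auto
    note el = this
    have "(p, q) \<in> r" "(s, u) \<in> r" "(p, u) \<notin> r" "(s, q) \<notin> r"
      using el by (simp_all add: fr two_plus_two_def)
    moreover have "p \<noteq> q" "s \<noteq> u" using el by auto
    moreover have "p \<in> Field r" "q \<in> Field r" "s \<in> Field r" "u \<in> Field r" using el A(1) by auto
    \<comment> \<open>Together with \<open>b q < e s\<close> and \<open>b u < e p\<close> this
      closes up to \<open>e p < e p\<close>.\<close>
    ultimately have "e p \<le> b q" "e s \<le> b u" "\<not> e p \<le> b u" "\<not> e s \<le> b q"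
      using R(3) by blast+
    thus False by linarith
  qed
  ultimately show ?thesis unfolding interval_order_def by blast
qed

text \<open>If neither down-set contains the other, take \<open>p\<close> below \<open>x\<close>
  only and \<open>q\<close> below \<open>y\<close> only: the chains \<open>p < x\<close> and
  \<open>q < y\<close> form a copy of \<open>two_plus_two\<close>.\<close>

lemma interval_order_underS_chain:
  assumes io: "interval_order r" and "x \<in> Field r" "y \<in> Field r"
  shows "underS r x \<subseteq> underS r y \<or> underS r y \<subseteq> underS r x"
proof (rule ccontr)
  assume "\<not> ?thesis"
  then obtain p q where p: "p \<in> underS r x" "p \<notin> underS r y"
    and q: "q \<in> underS r y" "q \<notin> underS r x" by auto
  have po: "refl_on (Field r) r" "trans r" "antisym r"
    using io by (auto simp: interval_order_def finite_poset_def partial_order_on_def preorder_on_def)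
  have fld: "p \<in> Field r" "q \<in> Field r" using p q by (auto simp: underS_def intro: FieldI1)
  have refl: "(z, z) \<in> r" if "z \<in> Field r" for z using po(1) that by (auto simp: refl_on_def)
  have tr: "(u, w) \<in> r" if "(u, z) \<in> r" "(z, w) \<in> r" for u z w using po(2) that by (rule transD)
  have as: "u = z" if "(u, z) \<in> r" "(z, u) \<in> r" for u z using po(3) that by (rule antisymD)
  have pq: "(p, x) \<in> r" "p \<noteq> x" "(q, y) \<in> r" "q \<noteq> y"
    "(p, y) \<notin> r \<or> p = y" "(q, x) \<notin> r \<or> q = x"
    using p q by (auto simp: underS_def)
  have neq: "p \<noteq> y" "q \<noteq> x"
    using pq tr as by metis+
  have nr: "(p, y) \<notin> r" "(q, x) \<notin> r" using pq neq by auto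
  \<comment> \<open>Each of the first six relations would put \<open>p\<close> below
    \<open>y\<close> or \<open>q\<close> below \<open>x\<close> by transitivity; the last two would
    violate antisymmetry.\<close>
  have nr2: "(p, q) \<notin> r" "(q, p) \<notin> r" "(x, y) \<notin> r" "(y, x) \<notin> r"
    "(x, q) \<notin> r" "(y, p) \<notin> r" "(x, p) \<notin> r" "(y, q) \<notin> r"
    using nr pq tr as by metis+
  have neq2: "p \<noteq> q" "x \<noteq> y" using nr2 refl fld assms by auto
  let ?A = "{p, x, q, y}"
  define f where "f = (\<lambda>z. if z = p then 0 else if z = x then 1 else if z = q then 2 else (3::nat))"
  have fv: "f p = 0" "f x = 1" "f q = 2" "f y = 3"
    using neq neq2 pq by (auto simp: f_def)
  have FA: "Field (Restr r ?A) = ?A"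
    using Refl_Field_Restr2[OF po(1), of ?A] fld assms by blast
  have FT: "Field two_plus_two = {0,1,2,3}" by (auto simp: two_plus_two_def Field_def)
  have "bij_betw f ?A {0,1,2,3}"
    unfolding bij_betw_def inj_on_def using fv by auto
  moreover have "\<forall>u\<in>?A. \<forall>w\<in>?A. (u, w) \<in> Restr r ?A \<longleftrightarrow> (f u, f w) \<in> two_plus_two"
    using fv nr nr2 pq neq neq2 neq[symmetric] neq2[symmetric] refl[OF fld(1)] refl[OF fld(2)] refl[OF assms(2)] refl[OF assms(3)]
    by (simp add: two_plus_two_def)
  ultimately have "poset_isomorphic (Restr r ?A) two_plus_two"
    unfolding poset_isomorphic_def FA FT by blast
  moreover have "?A \<subseteq> Field r" using fld assms by auto
  ultimately show False using io unfolding interval_order_def by blast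
qed

text \<open>When \<open>x\<close> is below \<open>y\<close>, every down-set missing \<open>x\<close>
  is strictly inside \<open>underS r y\<close>, as the down-sets form a chain. Otherwise
  \<open>underS r y\<close> itself misses \<open>x\<close>, and so do all down-sets inside it.
  Comparing cardinalities gives \<open>le\<close> and \<open>less\<close>.\<close>

lemma interval_rep_exists:
  assumes io: "interval_order r"
  shows "interval_rep r (mag r) (left_end r) (right_end r)"
proof -
  let ?DD = "underS r ` Field r"
  have fin: "finite (Field r)" and refl: "refl_on (Field r) r"
    using io by (auto simp: interval_order_def finite_poset_def partial_order_on_def preorder_on_def)
  have chain: "D \<subseteq> E \<or> E \<subseteq> D" if "D \<in> ?DD" "E \<in> ?DD" for D E
    using interval_order_underS_chain[OF io] that by blast
  have le: "right_end r x \<le> left_end r y" if "x \<in> underS r y" "y \<in> Field r" for x y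
  proof -
    have "{D \<in> ?DD. x \<notin> D} \<subseteq> {D \<in> ?DD. D \<subset> underS r y}"
      using chain[of _ "underS r y"] that by blast
    thus ?thesis unfolding right_end_def left_end_def by (intro card_mono) (use fin in auto)
  qed
  have less: "left_end r y < right_end r x" if "x \<notin> underS r y" "y \<in> Field r" for x y
  proof -
    have "{D \<in> ?DD. D \<subset> underS r y} \<subseteq> {D \<in> ?DD. x \<notin> D}" using that by blast
    moreover have "underS r y \<in> {D \<in> ?DD. x \<notin> D} - {D \<in> ?DD. D \<subset> underS r y}"
      using that by blast
    ultimately have "{D \<in> ?DD. D \<subset> underS r y} \<subset> {D \<in> ?DD. x \<notin> D}" by blast
    thus ?thesis unfolding right_end_def left_end_def by (intro psubset_card_mono) (use fin in auto)
  qed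
  define l where "l D = card {E \<in> ?DD. E \<subset> D}" for D
  have left: "left_end r x = l (underS r x)" for x by (simp add: left_end_def l_def)
  have l_less: "l D < l E" if "D \<in> ?DD" "E \<in> ?DD" "D \<subset> E" for D E
    unfolding l_def by (intro psubset_card_mono) (use fin that in auto)
  have inj: "inj_on l ?DD"
  proof (rule inj_onI, rule ccontr)
    fix D E assume DE: "D \<in> ?DD" "E \<in> ?DD" "l D = l E" "D \<noteq> E"
    hence "D \<subset> E \<or> E \<subset> D" using chain[of D E] by blast
    thus False using l_less DE by (metis less_irrefl)
  qed
  have l_mag: "l D < mag r" if "D \<in> ?DD" for D
    unfolding l_def mag_def by (intro psubset_card_mono) (use fin that in auto)
  have "l ` ?DD = {..<mag r}"
    by (intro card_subset_eq) (use l_mag card_image[OF inj] in \<open>auto simp: mag_def\<close>)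
  hence lefts: "left_end r ` Field r = {..<mag r}"
    by (simp add: left image_image)
  have right_le: "right_end r x \<le> mag r" for x
    unfolding right_end_def mag_def by (intro card_mono) (use fin in auto)
  have self: "left_end r x < right_end r x" if "x \<in> Field r" for x
    using less[of x x] that by (simp add: underS_def)
  have "right_end r ` Field r = {1..mag r}"
  proof (intro equalityI subsetI)
    fix k assume "k \<in> right_end r ` Field r"
    then obtain x where "x \<in> Field r" "k = right_end r x" by blast
    thus "k \<in> {1..mag r}" using self[of x] right_le[of x] by simp
  next
    fix k assume k: "k \<in> {1..mag r}"
    \<comment> \<open>For right end \<open>k\<close>, compare the down-sets of rank
      \<open>k - 1\<close> and \<open>k\<close>, those of \<open>z\<close> and \<open>y\<close>: an
      element of the second but not of the first works. For \<open>k = mag r\<close> there is no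
      second one, and \<open>z\<close> itself works.\<close>
    hence "k - 1 \<in> left_end r ` Field r" unfolding lefts by auto
    then obtain z where z: "z \<in> Field r" "left_end r z = k - 1" by force
    show "k \<in> right_end r ` Field r"
    proof (cases "k = mag r")
      case True
      hence "right_end r z = k" using self[of z] right_le[of z] z k by simp
      thus ?thesis using z by blast
    next
      case False
      hence "k \<in> left_end r ` Field r" using lefts k by simp
      then obtain y where y: "y \<in> Field r" "left_end r y = k" by force
      have "\<not> underS r y \<subseteq> underS r z"
      proof
        assume "underS r y \<subseteq> underS r z"
        hence "underS r y = underS r z \<or> underS r y \<subset> underS r z" by blast
        hence "l (underS r y) \<le> l (underS r z)"
          using l_less[of "underS r y" "underS r z"] y(1) z(1) by fastforce
        thus False using left[of y] left[of z] y(2) z(2) k by (simp, linarith)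
      qed
      then obtain x where x: "x \<in> underS r y" "x \<notin> underS r z" by blast
      have "right_end r x = k" using le[OF x(1) y(1)] less[OF x(2) z(1)] y z by simp
      moreover have "x \<in> Field r" using x by (auto simp: underS_def intro: FieldI1)
      ultimately show ?thesis by blast
    qed
  qed
  moreover have "(x, y) \<in> r \<longleftrightarrow> x = y \<or> right_end r x \<le> left_end r y"
    if "x \<in> Field r" "y \<in> Field r" for x y
  proof (cases "x = y")
    case True
    thus ?thesis using refl that by (simp add: refl_on_def)
  next
    case False
    hence "(x, y) \<in> r \<longleftrightarrow> x \<in> underS r y" by (simp add: underS_def)
    thus ?thesis using le[of x y] less[of x y] False that by auto
  qed
  ultimately show ?thesis
    using lefts self unfolding interval_rep_def by blast
qed

section \<open>Fishburn matrices\<close>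

text \<open>Upper triangular 0/1 matrices without zero rows or columns, given by the positions of
  their ones. Columns are numbered from \<open>1\<close>, so the diagonal cells are
  \<open>(i, i + 1)\<close> and every cell is a non-empty half-open interval.\<close>

definition fishburn_matrices :: "nat \<Rightarrow> (nat \<times> nat) set set" where
  "fishburn_matrices m =
     {M. (\<forall>(i, j)\<in>M. i < j) \<and> fst ` M = {..<m} \<and> snd ` M = {1..m}}"

text \<open>Cells are encoded as natural numbers because the isomorphism classes are formed among
  relations on \<open>nat\<close>.\<close>

definition cell_order :: "(nat \<times> nat) set \<Rightarrow> nat rel" where
  "cell_order M =
     {(x, y). prod_decode x \<in> M \<and> prod_decode y \<in> M \<and>
              (x = y \<or> snd (prod_decode x) \<le> fst (prod_decode y))}"

lemma Field_cell_order: "Field (cell_order M) = prod_encode ` M"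
  unfolding cell_order_def Field_def by (force intro: rev_image_eqI)

lemma interval_rep_cell_order:
  assumes "M \<in> fishburn_matrices m"
  shows "interval_rep (cell_order M) m (fst \<circ> prod_decode) (snd \<circ> prod_decode)"
proof -
  have "(prod_encode p, prod_encode q) \<in> cell_order M \<longleftrightarrow> p = q \<or> snd p \<le> fst q"
    if "p \<in> M" "q \<in> M" for p q
    using that by (auto simp: cell_order_def)
  moreover have "fst p < snd p" if "p \<in> M" for p
    using assms that by (auto simp: fishburn_matrices_def split_beta)
  ultimately show ?thesis
    using assms unfolding interval_rep_def Field_cell_order
    by (simp add: image_image fishburn_matrices_def prod_encode_eq)
qed

lemma fishburn_matrix_subset:
  assumes "M \<in> fishburn_matrices m"
  shows "M \<subseteq> {..<m} \<times> {1..m}"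
proof
  fix p assume "p \<in> M"
  hence "fst p \<in> fst ` M" "snd p \<in> snd ` M" by auto
  thus "p \<in> {..<m} \<times> {1..m}"
    using assms by (simp add: fishburn_matrices_def mem_Times_iff)
qed

lemma finite_fishburn_matrix: "M \<in> fishburn_matrices m \<Longrightarrow> finite M"
  by (rule finite_subset[OF fishburn_matrix_subset]) simp_all

lemma finite_fishburn_matrices: "finite (fishburn_matrices m)"
  by (rule finite_subset[of _ "Pow ({..<m} \<times> {1..m})"]) (use fishburn_matrix_subset in auto)

lemma cell_order_properties:
  assumes M: "M \<in> fishburn_matrices m"
  shows "interval_order (cell_order M)" and "primitive (cell_order M)"
    and "weight (cell_order M) = var_t ^ m * (\<Prod>p\<in>M. cell_weight m p)"
proof -
  note rep = interval_rep_cell_order[OF M]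
  have fin: "finite (Field (cell_order M))"
    by (simp add: Field_cell_order finite_fishburn_matrix[OF M])
  show "interval_order (cell_order M)" by (rule interval_order_interval_rep[OF rep fin])
  show "primitive (cell_order M)"
    by (simp add: primitive_interval_rep[OF rep] inj_prod_decode)
  show "weight (cell_order M) = var_t ^ m * (\<Prod>p\<in>M. cell_weight m p)"
    using weight_interval_rep[OF rep fin]
    by (simp add: Field_cell_order prod.reindex[OF inj_prod_encode])
qed

lemma poset_isomorphic_cell_order:
  assumes io: "interval_order r" and prim: "primitive r"
  obtains M where "M \<in> fishburn_matrices (mag r)" "poset_isomorphic r (cell_order M)"
proof -
  note rep = interval_rep_exists[OF io]
  define g where "g x = (left_end r x, right_end r x)" for x
  define M where "M = g ` Field r"
  have inj: "inj_on g (Field r)"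
    using prim by (simp add: primitive_interval_rep[OF rep] g_def [abs_def])
  have "M \<in> fishburn_matrices (mag r)"
    using rep unfolding fishburn_matrices_def M_def g_def interval_rep_def
    by (auto simp: image_image)
  moreover have "poset_isomorphic r (cell_order M)"
    unfolding poset_isomorphic_def
  proof (intro exI[of _ "prod_encode \<circ> g"] conjI ballI)
    show "bij_betw (prod_encode \<circ> g) (Field r) (Field (cell_order M))"
      unfolding bij_betw_def Field_cell_order M_def
      using comp_inj_on[OF inj inj_prod_encode] by (simp add: image_comp inj_prod_encode)
    fix x y assume xy: "x \<in> Field r" "y \<in> Field r"
    have "((prod_encode \<circ> g) x, (prod_encode \<circ> g) y) \<in> cell_order M \<longleftrightarrow>
        g x = g y \<or> snd (g x) \<le> fst (g y)"
      using xy by (simp add: cell_order_def M_def)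
    also have "\<dots> \<longleftrightarrow> x = y \<or> right_end r x \<le> left_end r y"
      using inj_onD[OF inj _ xy] by (auto simp: g_def)
    finally show "(x, y) \<in> r \<longleftrightarrow> ((prod_encode \<circ> g) x, (prod_encode \<circ> g) y) \<in> cell_order M"
      using interval_repD(3)[OF rep xy] by simp
  qed
  ultimately show thesis by (rule that)
qed

section \<open>Isomorphism classes and matrices\<close>

lemma interval_rep_iso:
  assumes rep: "interval_rep s m b e" and f: "bij_betw f (Field r) (Field s)"
    and fr: "\<forall>x\<in>Field r. \<forall>y\<in>Field r. (x, y) \<in> r \<longleftrightarrow> (f x, f y) \<in> s"
  shows "interval_rep r m (b \<circ> f) (e \<circ> f)"
proof -
  have im: "f ` Field r = Field s" and inj: "inj_on f (Field r)"
    using f by (auto simp: bij_betw_def)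
  have mem: "f x \<in> Field s" if "x \<in> Field r" for x using im that by blast
  have "(x, y) \<in> r \<longleftrightarrow> x = y \<or> e (f x) \<le> b (f y)" if xy: "x \<in> Field r" "y \<in> Field r" for x y
    using fr xy interval_repD(3)[OF rep mem[OF xy(1)] mem[OF xy(2)]] inj_on_eq_iff[OF inj xy]
    by blast
  moreover have "b (f x) < e (f x)" if "x \<in> Field r" for x
    using interval_repD(1)[OF rep mem[OF that]] .
  moreover have "(b \<circ> f) ` Field r = b ` Field s" "(e \<circ> f) ` Field r = e ` Field s"
    by (simp_all only: image_comp[symmetric] im)
  ultimately show ?thesis
    using rep unfolding interval_rep_def by simp
qed

text \<open>Pulling the representation of the second order back along the isomorphism gives another
  representation of the first. By uniqueness the ends agree, so the isomorphism preserves the cell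
  of each element.\<close>

lemma cell_order_iso_imp_eq:
  assumes M: "M \<in> fishburn_matrices m" and N: "N \<in> fishburn_matrices n"
    and iso: "poset_isomorphic (cell_order M) (cell_order N)"
  shows "M = N"
proof -
  let ?r = "cell_order M" and ?s = "cell_order N"
  from iso obtain f where f: "bij_betw f (Field ?r) (Field ?s)"
    and fr: "\<forall>x\<in>Field ?r. \<forall>y\<in>Field ?r. (x, y) \<in> ?r \<longleftrightarrow> (f x, f y) \<in> ?s"
    unfolding poset_isomorphic_def by blast
  note rM = interval_rep_cell_order[OF M]
  note rN = interval_rep_iso[OF interval_rep_cell_order[OF N] f fr]
  have eq: "prod_decode (f x) = prod_decode x" if "x \<in> Field ?r" for x
    using interval_rep_unique(2,3)[OF rM that] interval_rep_unique(2,3)[OF rN that]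
    by (simp add: prod_eq_iff)
  have cells: "prod_decode ` Field (cell_order K) = K" for K
    by (simp add: Field_cell_order image_image)
  have "N = prod_decode ` f ` Field ?r" using f cells[of N] by (simp add: bij_betw_def)
  also have "\<dots> = prod_decode ` Field ?r" using eq by (simp add: image_image)
  also have "\<dots> = M" by (rule cells)
  finally show ?thesis by simp
qed

text \<open>The index starts at \<open>1\<close> because the only matrix with \<open>m = 0\<close>
  is empty and yields the empty order, which is excluded.\<close>

lemma bij_betw_fishburn_primitive_interval_orders:
  "bij_betw (\<lambda>(m, M). iso_rel `` {cell_order M})
     (SIGMA m:{1..}. fishburn_matrices m) primitive_interval_orders"
proof (rule bij_betw_imageI)
  let ?S = "SIGMA m:{1..}. fishburn_matrices m"
  have fp: "finite_poset (cell_order M)" if "M \<in> fishburn_matrices m" for m M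
    using cell_order_properties(1)[OF that] by (simp add: interval_order_def)
  show "inj_on (\<lambda>(m, M). iso_rel `` {cell_order M}) ?S"
  proof (rule inj_onI, clarify)
    fix m M n N
    assume M: "M \<in> fishburn_matrices m" and N: "N \<in> fishburn_matrices n"
      and eq: "iso_rel `` {cell_order M} = iso_rel `` {cell_order N}"
    have "poset_isomorphic (cell_order M) (cell_order N)"
      using eq_equiv_class[OF eq equiv_iso_rel] fp[OF N] by (simp add: iso_rel_def)
    hence MN: "M = N" by (rule cell_order_iso_imp_eq[OF M N])
    have "{..<m} = {..<n}" using M N MN unfolding fishburn_matrices_def by auto
    with MN show "m = n \<and> M = N" by simp
  qed
  show "(\<lambda>(m, M). iso_rel `` {cell_order M}) ` ?S = primitive_interval_orders"
  proof (intro equalityI subsetI)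
    fix C assume "C \<in> (\<lambda>(m, M). iso_rel `` {cell_order M}) ` ?S"
    then obtain m M where mM: "m \<ge> 1" "M \<in> fishburn_matrices m" "C = iso_rel `` {cell_order M}"
      by auto
    have "M \<noteq> {}" using mM by (auto simp: fishburn_matrices_def)
    thus "C \<in> primitive_interval_orders"
      unfolding primitive_interval_orders_def mM(3)
      using cell_order_properties(1,2)[OF mM(2)]
      by (intro quotientI) (simp add: Field_cell_order)
  next
    fix C assume "C \<in> primitive_interval_orders"
    then obtain r where r: "Field r \<noteq> {}" "interval_order r" "primitive r" "C = iso_rel `` {r}"
      unfolding primitive_interval_orders_def by (auto elim!: quotientE)
    obtain M where M: "M \<in> fishburn_matrices (mag r)" "poset_isomorphic r (cell_order M)"
      using poset_isomorphic_cell_order[OF r(2,3)] by blast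
    have "finite (Field r)" using r(2) by (simp add: interval_order_def finite_poset_def)
    hence "mag r \<ge> 1" using r(1) by (simp add: mag_def Suc_le_eq card_gt_0_iff)
    moreover have "(r, cell_order M) \<in> iso_rel"
      using M fp[OF M(1)] r(2) by (simp add: iso_rel_def interval_order_def)
    hence "C = iso_rel `` {cell_order M}"
      using equiv_class_eq[OF equiv_iso_rel] r(4) by blast
    ultimately show "C \<in> (\<lambda>(m, M). iso_rel `` {cell_order M}) ` ?S"
      using M(1) by force
  qed
qed

section \<open>Inclusion-exclusion over the columns\<close>

text \<open>
  One step of this recursion decides whether the first of the remaining columns belongs to the
  column set: the difference \<open>f (Suc k) - f k\<close> carries the sign, \<open>\<alpha> k\<close> the weight of the row.
\<close>

primrec level_sum :: "(nat \<Rightarrow> 'a::comm_ring_1) \<Rightarrow> nat \<Rightarrow> (nat \<Rightarrow> 'a) \<Rightarrow> 'a" where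
  "level_sum \<alpha> 0 f = f 0"
| "level_sum \<alpha> (Suc n) f = level_sum \<alpha> n (\<lambda>k. \<alpha> k * (f (Suc k) - f k))"

lemma sum_Pow_insert:
  assumes "finite A" "a \<notin> A"
  shows "sum g (Pow (insert a A)) = (\<Sum>T\<in>Pow A. g T + g (insert a T))"
proof -
  have "inj_on (insert a) (Pow A)"
    by (rule inj_onI) (use assms in \<open>auto dest: insert_ident[THEN iffD1, rotated 2]\<close>)
  moreover have "Pow A \<inter> insert a ` Pow A = {}" using assms by auto
  ultimately show ?thesis
    using assms by (simp add: Pow_insert sum.union_disjoint sum.reindex sum.distrib)
qed

text \<open>Split the column sets by whether they contain the first column \<open>a\<close>. Row
  \<open>i\<close> sees only columns after \<open>i\<close>, so adding \<open>a\<close> changes just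
  the sign and the argument of \<open>f\<close>. Row \<open>a\<close> sees all of the remaining set,
  so its factor depends on the cardinality alone and is absorbed into \<open>f\<close>; hence the
  induction keeps \<open>f\<close> arbitrary.\<close>

lemma signed_subset_sum_eq_level_sum:
  fixes f \<alpha> :: "nat \<Rightarrow> 'a::comm_ring_1"
  assumes "a \<le> m"
  shows "(\<Sum>T\<in>Pow {a..<m}. (-1) ^ card ({a..<m} - T) * f (card T) *
            (\<Prod>i\<in>{a..<m}. \<alpha> (card (T \<inter> {i<..<m})))) = level_sum \<alpha> (m - a) f"
  using assms
proof (induction a arbitrary: f rule: inc_induct)
  case base
  show ?case by simp
next
  case (step a)
  let ?A = "{Suc a..<m}"
  define h where "h T i = \<alpha> (card (T \<inter> {i<..<m}))" for T i
  have ins: "{a..<m} = insert a ?A" using step.hyps by auto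
  have "(\<Sum>T\<in>Pow {a..<m}. (-1) ^ card ({a..<m} - T) * f (card T) * (\<Prod>i\<in>{a..<m}. h T i)) =
    (\<Sum>T\<in>Pow ?A. (-1) ^ card (insert a ?A - T) * f (card T) * (\<Prod>i\<in>insert a ?A. h T i) +
      (-1) ^ card (insert a ?A - insert a T) * f (card (insert a T)) *
        (\<Prod>i\<in>insert a ?A. h (insert a T) i))"
    unfolding ins by (rule sum_Pow_insert) auto
  also have "\<dots> = (\<Sum>T\<in>Pow ?A. (-1) ^ card (?A - T) *
      (\<alpha> (card T) * (f (Suc (card T)) - f (card T))) * (\<Prod>i\<in>?A. h T i))"
  proof (rule sum.cong[OF refl])
    fix T assume "T \<in> Pow ?A"
    hence T: "T \<subseteq> ?A" by simp
    have fT: "finite T" using T by (rule finite_subset) simp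
    have aT: "a \<notin> T" using T by auto
    have "T \<inter> {a<..<m} = T" using T by auto
    hence ha: "h T a = \<alpha> (card T)" by (simp add: h_def)
    have hi: "h (insert a T) i = h T i" if "i \<ge> a" for i
      using that by (simp add: h_def)
    have c1: "card (insert a ?A - T) = Suc (card (?A - T))"
      using aT by (simp add: insert_Diff_if)
    have c2: "insert a ?A - insert a T = ?A - T" by auto
    have p: "(\<Prod>i\<in>insert a ?A. h S i) = h S a * (\<Prod>i\<in>?A. h S i)" for S by simp
    have q: "(\<Prod>i\<in>?A. h (insert a T) i) = (\<Prod>i\<in>?A. h T i)"
      by (rule prod.cong) (auto intro!: hi)
    show "(-1) ^ card (insert a ?A - T) * f (card T) * (\<Prod>i\<in>insert a ?A. h T i) +
      (-1) ^ card (insert a ?A - insert a T) * f (card (insert a T)) *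
        (\<Prod>i\<in>insert a ?A. h (insert a T) i) =
      (-1) ^ card (?A - T) *
      (\<alpha> (card T) * (f (Suc (card T)) - f (card T))) * (\<Prod>i\<in>?A. h T i)"
      unfolding p q c1 c2 hi[OF order_refl] ha using aT fT by (simp add: algebra_simps)
  qed
  also have "\<dots> = level_sum \<alpha> (m - Suc a) (\<lambda>k. \<alpha> k * (f (Suc k) - f k))"
    unfolding h_def by (rule step.IH)
  also have "\<dots> = level_sum \<alpha> (m - a) f"
    using step.hyps by (simp add: Suc_diff_Suc[symmetric])
  finally show ?case unfolding h_def .
qed

section \<open>Generating polynomial of the Fishburn matrices\<close>

lemma sum_nonempty_subsets:
  fixes w :: "'b \<Rightarrow> 'a::comm_ring_1"
  assumes "finite C"
  shows "(\<Sum>B\<in>Pow C - {{}}. \<Prod>c\<in>B. w c) = (\<Prod>c\<in>C. 1 + w c) - 1"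
proof -
  have "(\<Prod>c\<in>C. 1 + w c) = (\<Prod>c\<in>C. w c + 1)" by (simp add: add.commute)
  also have "\<dots> = (\<Sum>B\<in>Pow C. \<Prod>c\<in>B. w c)" using assms by (simp add: prod_add)
  finally show ?thesis using assms by (simp add: sum_diff1)
qed

text \<open>A set of cells amounts to a family of rows, chosen independently among the non-empty
  subsets, so the sum factors; the \<open>- 1\<close> removes the empty row.\<close>

lemma sum_all_rows_nonempty:
  fixes w :: "'i \<times> 'b \<Rightarrow> 'a::comm_ring_1"
  assumes I: "finite I" and C: "\<And>i. i \<in> I \<Longrightarrow> finite (C i)"
  shows "(\<Sum>M | M \<subseteq> Sigma I C \<and> fst ` M = I. \<Prod>p\<in>M. w p) =
    (\<Prod>i\<in>I. (\<Prod>c\<in>C i. 1 + w (i, c)) - 1)"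
proof -
  have "(\<Prod>i\<in>I. (\<Prod>c\<in>C i. 1 + w (i, c)) - 1) =
    (\<Prod>i\<in>I. \<Sum>B\<in>Pow (C i) - {{}}. \<Prod>c\<in>B. w (i, c))"
    by (intro prod.cong refl sum_nonempty_subsets[symmetric] C)
  also have "\<dots> = (\<Sum>g\<in>PiE I (\<lambda>i. Pow (C i) - {{}}). \<Prod>i\<in>I. \<Prod>c\<in>g i. w (i, c))"
    by (rule prod_sum_PiE) (use I C in auto)
  also have "\<dots> = (\<Sum>M | M \<subseteq> Sigma I C \<and> fst ` M = I. \<Prod>p\<in>M. w p)"
  proof (rule sum.reindex_bij_witness[where i = "\<lambda>M. \<lambda>i\<in>I. M `` {i}" and j = "\<lambda>g. Sigma I g"])
    fix g assume g: "g \<in> PiE I (\<lambda>i. Pow (C i) - {{}})"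
    show "(\<lambda>i\<in>I. Sigma I g `` {i}) = g"
      using g by (intro ext) (auto simp: PiE_def extensional_def)
    have "fst ` Sigma I g = I"
      using g by (force simp: PiE_def Pi_def image_iff)
    moreover have "Sigma I g \<subseteq> Sigma I C" using g by (auto simp: PiE_def Pi_def)
    ultimately show "Sigma I g \<in> {M. M \<subseteq> Sigma I C \<and> fst ` M = I}" by simp
    have "finite (g i)" if "i \<in> I" for i
      using g that C[OF that] by (auto simp: PiE_def Pi_def intro: finite_subset)
    thus "(\<Prod>p\<in>Sigma I g. w p) = (\<Prod>i\<in>I. \<Prod>c\<in>g i. w (i, c))"
      using I by (simp add: prod.Sigma)
  next
    fix M assume "M \<in> {M. M \<subseteq> Sigma I C \<and> fst ` M = I}"
    hence M: "M \<subseteq> Sigma I C" "fst ` M = I" by auto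
    show "Sigma I (\<lambda>i\<in>I. M `` {i}) = M" using M(1) by auto
    have "M `` {i} \<noteq> {}" if "i \<in> I" for i
    proof -
      have "i \<in> fst ` M" using M(2) that by simp
      thus ?thesis by force
    qed
    moreover have "M `` {i} \<subseteq> C i" for i using M(1) by auto
    ultimately show "(\<lambda>i\<in>I. M `` {i}) \<in> PiE I (\<lambda>i. Pow (C i) - {{}})" by auto
  qed
  finally show ?thesis by simp
qed

text \<open>The row condition is imposed directly, because the sum over \<open>R T\<close> (no empty
  row, all cells in columns of \<open>T\<close>) factors over the rows; the column condition is
  imposed by the alternating sum over \<open>T\<close>.\<close>

lemma sum_fishburn_matrices_inclusion_exclusion:
  fixes w :: "nat \<times> nat \<Rightarrow> 'a::comm_ring_1"
  shows "(\<Sum>M\<in>fishburn_matrices m. \<Prod>p\<in>M. w p) =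
    (\<Sum>T\<in>Pow {1..m}. (-1) ^ card ({1..m} - T) *
       (\<Prod>i<m. (\<Prod>j\<in>T \<inter> {i<..m}. 1 + w (i, j)) - 1))"
proof -
  define R where "R T = {M. M \<subseteq> (SIGMA i:{..<m}. T \<inter> {i<..m}) \<and> fst ` M = {..<m}}" for T
  have fin: "finite (R T)" for T
    by (rule finite_subset[of _ "Pow (SIGMA i:{..<m}. T \<inter> {i<..m})"]) (auto simp: R_def)
  have snd_R: "snd ` M \<subseteq> {1..m}" if "M \<in> R T" for M T
    using that unfolding R_def by fastforce
  have RT: "{M \<in> R {1..m}. snd ` M \<subseteq> T} = R T" if "T \<subseteq> {1..m}" for T
  proof -
    have "(SIGMA i:{..<m}. T \<inter> {i<..m}) =
        (SIGMA i:{..<m}. {1..m} \<inter> {i<..m}) \<inter> UNIV \<times> T"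
      using that by auto
    moreover have "snd ` M \<subseteq> T \<longleftrightarrow> M \<subseteq> UNIV \<times> T" for M :: "(nat \<times> nat) set"
      by force
    ultimately show ?thesis unfolding R_def by (simp add: conj_ac)
  qed
  have fish: "fishburn_matrices m = {M \<in> R {1..m}. snd ` M = {1..m}}"
  proof (intro equalityI subsetI)
    fix M assume M: "M \<in> fishburn_matrices m"
    have "M \<subseteq> (SIGMA i:{..<m}. {1..m} \<inter> {i<..m})"
    proof
      fix p assume p: "p \<in> M"
      hence "p \<in> {..<m} \<times> {1..m}" using fishburn_matrix_subset[OF M] by (rule rev_subsetD)
      moreover have "case p of (i, j) \<Rightarrow> i < j"
        using M p unfolding fishburn_matrices_def by blast
      ultimately show "p \<in> (SIGMA i:{..<m}. {1..m} \<inter> {i<..m})" by (cases p) simp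
    qed
    thus "M \<in> {M \<in> R {1..m}. snd ` M = {1..m}}"
      using M by (simp add: R_def fishburn_matrices_def)
  next
    fix M assume "M \<in> {M \<in> R {1..m}. snd ` M = {1..m}}"
    hence M: "M \<subseteq> (SIGMA i:{..<m}. {1..m} \<inter> {i<..m})" "fst ` M = {..<m}" "snd ` M = {1..m}"
      by (simp_all add: R_def)
    have "\<forall>(i, j)\<in>M. i < j" using M(1) by auto
    thus "M \<in> fishburn_matrices m" using M by (simp add: fishburn_matrices_def)
  qed
  have signs: "(\<Sum>T\<in>Pow {1..m}. (-1) ^ card ({1..m} - T) * (if snd ` M \<subseteq> T then 1 else 0)) =
      (if snd ` M = {1..m} then 1 else 0 :: 'a)" (is "?L = _")
    if M: "M \<in> R {1..m}" for M
  proof -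
    \<comment> \<open>Expand a product with the factor \<open>1\<close> for each occupied column and
      \<open>0\<close> for each empty one; \<open>T\<close> collects the columns where the summand
      \<open>1\<close> is chosen.\<close>
    have "(\<Prod>j\<in>{1..m}. 1 + (if j \<in> snd ` M then 0 else -1 :: 'a)) =
      (\<Sum>T\<in>Pow {1..m}. \<Prod>j\<in>{1..m} - T. if j \<in> snd ` M then 0 else -1)"
      by (simp add: prod_add)
    also have "\<dots> = ?L"
    proof (rule sum.cong[OF refl])
      fix T assume "T \<in> Pow {1..m}"
      show "(\<Prod>j\<in>{1..m} - T. if j \<in> snd ` M then 0 else -1 :: 'a) =
        (-1) ^ card ({1..m} - T) * (if snd ` M \<subseteq> T then 1 else 0)"
      proof (cases "snd ` M \<subseteq> T")
        case True
        hence "(\<Prod>j\<in>{1..m} - T. if j \<in> snd ` M then 0 else -1 :: 'a) = (\<Prod>j\<in>{1..m} - T. -1)"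
          by (intro prod.cong) auto
        thus ?thesis using True by simp
      next
        case False
        then obtain j where "j \<in> snd ` M" "j \<notin> T" by blast
        hence "j \<in> {1..m} - T" "j \<in> snd ` M" using snd_R[OF M] by auto
        hence "(\<Prod>j\<in>{1..m} - T. if j \<in> snd ` M then 0 else -1 :: 'a) = 0"
          by (intro prod_zero) (auto intro!: bexI[of _ j])
        thus ?thesis using False by simp
      qed
    qed
    also have "(\<Prod>j\<in>{1..m}. 1 + (if j \<in> snd ` M then 0 else -1 :: 'a)) =
      (if snd ` M = {1..m} then 1 else 0)"
    proof (cases "snd ` M = {1..m}")
      case True
      thus ?thesis by simp
    next
      case False
      then obtain j where "j \<in> {1..m}" "j \<notin> snd ` M" using snd_R[OF M] by blast
      hence "(\<Prod>j\<in>{1..m}. 1 + (if j \<in> snd ` M then 0 else -1 :: 'a)) = 0"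
        by (intro prod_zero) (auto intro!: bexI[of _ j])
      thus ?thesis using False by simp
    qed
    finally show ?thesis by simp
  qed
  have "(\<Sum>M\<in>fishburn_matrices m. \<Prod>p\<in>M. w p) =
    (\<Sum>M\<in>R {1..m}. (\<Prod>p\<in>M. w p) * (if snd ` M = {1..m} then 1 else 0))"
    unfolding fish by (rule sum.mono_neutral_cong_left) (use fin in auto)
  also have "\<dots> = (\<Sum>M\<in>R {1..m}. \<Sum>T\<in>Pow {1..m}.
      (-1) ^ card ({1..m} - T) * (if snd ` M \<subseteq> T then \<Prod>p\<in>M. w p else 0))"
  proof (rule sum.cong[OF refl])
    fix M assume "M \<in> R {1..m}"
    show "(\<Prod>p\<in>M. w p) * (if snd ` M = {1..m} then 1 else 0) = (\<Sum>T\<in>Pow {1..m}.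
      (-1) ^ card ({1..m} - T) * (if snd ` M \<subseteq> T then \<Prod>p\<in>M. w p else 0))"
      unfolding signs[OF \<open>M \<in> R {1..m}\<close>, symmetric] sum_distrib_left
      by (rule sum.cong) simp_all
  qed
  also have "\<dots> = (\<Sum>T\<in>Pow {1..m}. (-1) ^ card ({1..m} - T) *
      (\<Sum>M\<in>R {1..m}. if snd ` M \<subseteq> T then \<Prod>p\<in>M. w p else 0))"
    by (subst sum.swap) (simp add: sum_distrib_left)
  also have "\<dots> = (\<Sum>T\<in>Pow {1..m}. (-1) ^ card ({1..m} - T) *
       (\<Prod>i<m. (\<Prod>j\<in>T \<inter> {i<..m}. 1 + w (i, j)) - 1))"
  proof (rule sum.cong[OF refl])
    fix T assume "T \<in> Pow {1..m}"
    hence T: "T \<subseteq> {1..m}" by simp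
    have "(\<Sum>M\<in>R {1..m}. if snd ` M \<subseteq> T then \<Prod>p\<in>M. w p else 0) = (\<Sum>M\<in>R T. \<Prod>p\<in>M. w p)"
      unfolding RT[OF T, symmetric] using fin by (simp add: sum.If_cases Int_def)
    also have "\<dots> = (\<Prod>i<m. (\<Prod>j\<in>T \<inter> {i<..m}. 1 + w (i, j)) - 1)"
      unfolding R_def by (rule sum_all_rows_nonempty) auto
    finally show "(-1) ^ card ({1..m} - T) *
        (\<Sum>M\<in>R {1..m}. if snd ` M \<subseteq> T then \<Prod>p\<in>M. w p else 0) =
      (-1) ^ card ({1..m} - T) * (\<Prod>i<m. (\<Prod>j\<in>T \<inter> {i<..m}. 1 + w (i, j)) - 1)"
      by simp
  qed
  finally show ?thesis .
qed

text \<open>Only column sets \<open>insert m T\<close> with \<open>T\<close> inside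
  \<open>{1..<m}\<close> survive. In row \<open>i > 0\<close>, column \<open>m\<close> gives the
  factor \<open>1 + var_v\<close> and each column of \<open>T\<close> after \<open>i\<close> a
  factor \<open>1 + var_w\<close>, which is the shape of \<open>V\<close>. Row \<open>0\<close> sees
  all of \<open>T\<close> and becomes the \<open>f\<close> of the recursion; the other
  \<open>m - 1\<close> rows are its steps.\<close>

lemma sum_fishburn_matrices_eq_level_sum:
  assumes m: "m \<ge> 1"
  shows "(\<Sum>M\<in>fishburn_matrices m. \<Prod>p\<in>M. cell_weight m p) =
    level_sum (\<lambda>k. V k var_v var_w) (m - 1) (\<lambda>k. V k var_x var_y)"
proof -
  let ?w = "cell_weight m"
  let ?A = "{1..<m}"
  define row where "row T i = (\<Prod>j\<in>T \<inter> {i<..m}. 1 + ?w (i, j)) - 1" for T i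
  have ins: "{1..m} = insert m ?A" "{..<m} = insert 0 ?A" using m by auto
  have row_eq: "row (insert m T) i = (1 + ?w (i, m)) * (\<Prod>j\<in>T \<inter> {i<..<m}. 1 + ?w (i, j)) - 1"
    if "T \<subseteq> ?A" "i < m" for T i
  proof -
    have "insert m T \<inter> {i<..m} = insert m (T \<inter> {i<..<m})" using that by auto
    thus ?thesis unfolding row_def by simp
  qed
  have row_0: "row (insert m T) 0 = V (card T) var_x var_y" if T: "T \<subseteq> ?A" for T
  proof -
    have "T \<inter> {0<..<m} = T" using T by auto
    moreover have "(\<Prod>j\<in>T. 1 + ?w (0, j)) = (\<Prod>j\<in>T. 1 + var_y)"
      using T by (intro prod.cong) (auto simp: cell_weight_def)
    ultimately show ?thesis
      using row_eq[OF T, of 0] m by (simp add: cell_weight_def V_def add.commute)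
  qed
  have row_pos: "row (insert m T) i = V (card (T \<inter> {i<..<m})) var_v var_w"
    if T: "T \<subseteq> ?A" and i: "i \<in> ?A" for T i
  proof -
    have "(\<Prod>j\<in>T \<inter> {i<..<m}. 1 + ?w (i, j)) = (\<Prod>j\<in>T \<inter> {i<..<m}. 1 + var_w)"
      using i by (intro prod.cong) (auto simp: cell_weight_def)
    thus ?thesis
      using row_eq[OF T, of i] i by (simp add: cell_weight_def V_def add.commute)
  qed
  have "(\<Sum>M\<in>fishburn_matrices m. \<Prod>p\<in>M. ?w p) =
    (\<Sum>T\<in>Pow (insert m ?A). (-1) ^ card (insert m ?A - T) * (\<Prod>i<m. row T i))"
    unfolding sum_fishburn_matrices_inclusion_exclusion ins(1) row_def ..
  also have "\<dots> = (\<Sum>T\<in>Pow ?A.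
      (-1) ^ card (insert m ?A - T) * (\<Prod>i<m. row T i) +
      (-1) ^ card (insert m ?A - insert m T) * (\<Prod>i<m. row (insert m T) i))"
    by (rule sum_Pow_insert) auto
  also have "\<dots> = (\<Sum>T\<in>Pow ?A. (-1) ^ card (?A - T) * V (card T) var_x var_y *
      (\<Prod>i\<in>?A. V (card (T \<inter> {i<..<m})) var_v var_w))"
  proof (rule sum.cong[OF refl])
    fix T assume "T \<in> Pow ?A"
    hence T: "T \<subseteq> ?A" by simp
    \<comment> \<open>A column set omitting \<open>m\<close> leaves no cell for the last row.\<close>
    have "T \<inter> {m - 1<..m} = {}" using T by auto
    hence "row T (m - 1) = 0" by (simp add: row_def)
    hence 1: "(\<Prod>i<m. row T i) = 0"
      by (intro prod_zero) (use m in \<open>auto intro!: bexI[of _ "m - 1"]\<close>)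
    have 2: "insert m ?A - insert m T = ?A - T" by auto
    have 3: "(\<Prod>i<m. row (insert m T) i) =
        V (card T) var_x var_y * (\<Prod>i\<in>?A. V (card (T \<inter> {i<..<m})) var_v var_w)"
      unfolding ins(2) by (simp add: row_0[OF T] row_pos[OF T])
    show "(-1) ^ card (insert m ?A - T) * (\<Prod>i<m. row T i) +
        (-1) ^ card (insert m ?A - insert m T) * (\<Prod>i<m. row (insert m T) i) =
      (-1) ^ card (?A - T) * V (card T) var_x var_y *
        (\<Prod>i\<in>?A. V (card (T \<inter> {i<..<m})) var_v var_w)"
      unfolding 1 2 3 by (simp add: mult.assoc)
  qed
  also have "\<dots> = level_sum (\<lambda>k. V k var_v var_w) (m - 1) (\<lambda>k. V k var_x var_y)"
    by (rule signed_subset_sum_eq_level_sum[OF m])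
  finally show ?thesis .
qed

section \<open>The generating function\<close>

lemma fps_nth_0_level_sum:
  "fps_nth (level_sum \<alpha> n f) 0 =
     level_sum (\<lambda>k. fps_nth (\<alpha> k) 0) n (\<lambda>k. fps_nth (f k) 0)"
  by (induction n arbitrary: f) simp_all

text \<open>The hypotheses say that \<open>c n\<close> is \<open>X^n / (1 + \<alpha> n X)\<close>
  times the product of \<open>\<alpha> i / (1 + \<alpha> i X)\<close> over \<open>i < n\<close>,
  written without division since the coefficients form only a ring. Coefficient \<open>j\<close> of
  \<open>c n\<close> is the signed weight with which \<open>f n\<close> enters after
  \<open>j\<close> steps.\<close>

lemma level_sum_eq_sum_fps_nth:
  fixes \<alpha> :: "nat \<Rightarrow> 'a::comm_ring_1" and c :: "nat \<Rightarrow> 'a fps"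
  assumes c_0: "c 0 * (1 + fps_X * fps_const (\<alpha> 0)) = 1"
    and c_Suc: "\<And>n. c (Suc n) * (1 + fps_X * fps_const (\<alpha> (Suc n))) =
                     fps_X * (fps_const (\<alpha> n) * c n)"
    and "j < N"
  shows "(\<Sum>n<N. f n * fps_nth (c n) j) = level_sum \<alpha> j f"
proof -
  have mult: "c n * (1 + fps_X * fps_const a) = c n + fps_X * (fps_const a * c n)" for n a
    by (simp add: algebra_simps)
  have nth_0: "fps_nth (c n) 0 = (if n = 0 then 1 else 0)" for n
  proof (cases n)
    case 0
    thus ?thesis using arg_cong[OF c_0, of "\<lambda>F. fps_nth F 0"] by simp
  next
    case (Suc k)
    thus ?thesis using arg_cong[OF c_Suc[of k], of "\<lambda>F. fps_nth F 0"] by simp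
  qed
  have nth_Suc_0: "fps_nth (c 0) (Suc i) = - \<alpha> 0 * fps_nth (c 0) i" for i
    using arg_cong[OF c_0[unfolded mult], of "\<lambda>F. fps_nth F (Suc i)"]
    by (simp add: eq_neg_iff_add_eq_0)
  have nth_Suc_Suc: "fps_nth (c (Suc n)) (Suc i) =
      \<alpha> n * fps_nth (c n) i - \<alpha> (Suc n) * fps_nth (c (Suc n)) i" for n i
    using arg_cong[OF c_Suc[of n, unfolded mult], of "\<lambda>F. fps_nth F (Suc i)"]
    by (simp add: eq_diff_eq)
  \<comment> \<open>\<open>c n\<close> starts at \<open>X^n\<close>, so every \<open>N > j\<close>
    captures all contributions.\<close>
  have vanish: "fps_nth (c n) i = 0" if "i < n" for n i
    using that
  proof (induction i arbitrary: n)
    case 0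
    thus ?case by (simp add: nth_0)
  next
    case (Suc i)
    then obtain k where "n = Suc k" by (cases n) auto
    thus ?case using Suc by (simp add: nth_Suc_Suc)
  qed
  show ?thesis
    using \<open>j < N\<close>
  proof (induction j arbitrary: f N)
    case 0
    have "(\<Sum>n<N. f n * fps_nth (c n) 0) = (\<Sum>n<N. if n = 0 then f 0 else 0)"
      by (intro sum.cong) (auto simp: nth_0)
    thus ?case using 0 by simp
  next
    case (Suc j)
    then obtain N' where N: "N = Suc N'" "j < N'" by (cases N) auto
    have "(\<Sum>n<N. f n * fps_nth (c n) (Suc j)) =
      f 0 * fps_nth (c 0) (Suc j) + (\<Sum>n<N'. f (Suc n) * fps_nth (c (Suc n)) (Suc j))"
      unfolding N(1) by (rule sum.lessThan_Suc_shift)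
    also have "\<dots> = (\<Sum>n<N'. f (Suc n) * (\<alpha> n * fps_nth (c n) j)) -
      (f 0 * (\<alpha> 0 * fps_nth (c 0) j) +
       (\<Sum>n<N'. f (Suc n) * (\<alpha> (Suc n) * fps_nth (c (Suc n)) j)))"
      by (simp add: nth_Suc_0 nth_Suc_Suc right_diff_distrib sum_subtractf)
    also have "f 0 * (\<alpha> 0 * fps_nth (c 0) j) +
       (\<Sum>n<N'. f (Suc n) * (\<alpha> (Suc n) * fps_nth (c (Suc n)) j)) =
       (\<Sum>n<Suc N'. f n * (\<alpha> n * fps_nth (c n) j))"
      by (rule sum.lessThan_Suc_shift[symmetric])
    \<comment> \<open>The top term \<open>n = N'\<close> vanishes because \<open>j < N'\<close>.
      Both sums now run over the same \<open>c n\<close> and combine to one step of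
      \<open>level_sum\<close>.\<close>
    also have "\<dots> = (\<Sum>n<N'. f n * (\<alpha> n * fps_nth (c n) j))"
      using vanish[OF N(2)] by simp
    also have "(\<Sum>n<N'. f (Suc n) * (\<alpha> n * fps_nth (c n) j)) - \<dots> =
      (\<Sum>n<N'. (\<alpha> n * (f (Suc n) - f n)) * fps_nth (c n) j)"
      by (simp add: sum_subtractf[symmetric] algebra_simps)
    also have "\<dots> = level_sum \<alpha> (Suc j) f"
      using Suc.IH[OF N(2)] by simp
    finally show ?case .
  qed
qed

text \<open>Degree \<open>n\<close> receives contributions only from the finitely many pairs
  \<open>(n, M)\<close>, so its coefficient is constant once a partial sum contains them
  all.\<close>

lemma has_sum_graded_fps:
  fixes g :: "nat \<Rightarrow> 'b \<Rightarrow> 'a::comm_ring_1"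
  assumes fin: "\<And>m. m \<in> I \<Longrightarrow> finite (B m)"
  shows "((\<lambda>(m, M). fps_X ^ m * fps_const (g m M)) has_sum
           Abs_fps (\<lambda>m. if m \<in> I then \<Sum>M\<in>B m. g m M else 0)) (Sigma I B)"
  unfolding has_sum_def
proof (rule tendsto_fpsI)
  fix n
  let ?h = "\<lambda>(m, M). fps_X ^ m * fps_const (g m M)"
  define S where "S = {p \<in> Sigma I B. fst p = n}"
  have S: "S = (if n \<in> I then Pair n ` B n else {})" by (auto simp: S_def)
  have "finite S" using fin unfolding S by simp
  hence "eventually (\<lambda>F. finite F \<and> S \<subseteq> F \<and> F \<subseteq> Sigma I B) (finite_subsets_at_top (Sigma I B))"
    by (intro eventually_finite_subsets_at_top[THEN iffD2] exI[of _ S]) (auto simp: S_def)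
  thus "eventually (\<lambda>F. fps_nth (sum ?h F) n =
      fps_nth (Abs_fps (\<lambda>m. if m \<in> I then \<Sum>M\<in>B m. g m M else 0)) n)
      (finite_subsets_at_top (Sigma I B))"
  proof eventually_elim
    case (elim F)
    have nth: "fps_nth (?h p) n = (if fst p = n then g n (snd p) else 0)" for p
      by (cases p) (auto simp: fps_X_power_mult_nth)
    have "fps_nth (sum ?h F) n = (\<Sum>p\<in>F. if fst p = n then g n (snd p) else 0)"
      by (simp only: fps_sum_nth nth)
    also have "\<dots> = (\<Sum>p\<in>S. g n (snd p))"
      by (rule sum.mono_neutral_cong_right) (use elim in \<open>auto simp: S_def\<close>)
    also have "\<dots> = (if n \<in> I then \<Sum>M\<in>B n. g n M else 0)"
      unfolding S by (simp add: sum.reindex inj_on_def)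
    finally show ?case by simp
  qed
qed

section \<open>Series free of \<open>t\<close>\<close>

lemma V_const:
  "V n (fps_const a) (fps_const b) = fps_const (fps_nth (V n (fps_const a) (fps_const b)) 0)"
proof -
  have "V n (fps_const a) (fps_const b) = fps_const ((a + 1) * (b + 1) ^ n - 1)"
    unfolding V_def by (simp flip: fps_const_1_eq_1 add: fps_const_power)
  thus ?thesis by simp
qed

lemma prod_cell_weight_const:
  "(\<Prod>p\<in>M. cell_weight m p) = fps_const (fps_nth (\<Prod>p\<in>M. cell_weight m p) 0)"
proof (induction M rule: infinite_finite_induct)
  case (insert p M)
  have "cell_weight m p = fps_const (fps_nth (cell_weight m p) 0)"
    by (simp add: cell_weight_def var_x_def var_y_def var_v_def var_w_def)
  with insert.IH obtain a b where "cell_weight m p = fps_const a"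
    "(\<Prod>p\<in>M. cell_weight m p) = fps_const b" by blast
  thus ?case using insert.hyps by simp
qed simp_all

theorem theorem1:
  shows "class_weight summable_on primitive_interval_orders \<and>
    (\<lambda>n. var_t ^ (n + 1) * (V n var_x var_y / (1 + var_t * V n var_v var_w)) *
          (\<Prod>i<n. V i var_v var_w / (1 + var_t * V i var_v var_w))) sums P_series"
proof -
  \<comment> \<open>\<open>\<alpha> k\<close> and \<open>\<beta> k\<close> are the two instances of
    \<open>V k\<close> as elements of the coefficient ring, one level of power series below
    \<open>series\<close>.\<close>
  define \<alpha> where "\<alpha> k = fps_nth (V k var_v var_w) 0" for k
  define \<beta> where "\<beta> k = fps_nth (V k var_x var_y) 0" for k
  have V_\<alpha>: "V k var_v var_w = fps_const (\<alpha> k)" for k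
    unfolding \<alpha>_def var_v_def var_w_def by (rule V_const)
  have V_\<beta>: "V k var_x var_y = fps_const (\<beta> k)" for k
    unfolding \<beta>_def var_x_def var_y_def by (rule V_const)
  define Q :: series where "Q = Abs_fps (\<lambda>m. if m \<in> {1..} then level_sum \<alpha> (m - 1) \<beta> else 0)"

  let ?S = "SIGMA m:{1..}. fishburn_matrices m"
  have "((\<lambda>(m, M). fps_X ^ m * fps_const (fps_nth (\<Prod>p\<in>M. cell_weight m p) 0)) has_sum
      Abs_fps (\<lambda>m. if m \<in> {1..} then
        \<Sum>M\<in>fishburn_matrices m. fps_nth (\<Prod>p\<in>M. cell_weight m p) 0 else 0)) ?S"
    by (rule has_sum_graded_fps) (rule finite_fishburn_matrices)
  also have "(\<lambda>m. if m \<in> {1..} then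
        \<Sum>M\<in>fishburn_matrices m. fps_nth (\<Prod>p\<in>M. cell_weight m p) 0 else 0) =
      (\<lambda>m. if m \<in> {1..} then level_sum \<alpha> (m - 1) \<beta> else 0)"
  proof
    fix m
    have "(\<Sum>M\<in>fishburn_matrices m. fps_nth (\<Prod>p\<in>M. cell_weight m p) 0) =
        level_sum \<alpha> (m - 1) \<beta>" if "m \<ge> 1"
      using arg_cong[OF sum_fishburn_matrices_eq_level_sum[OF that], of "\<lambda>F. fps_nth F 0"]
      unfolding fps_sum_nth fps_nth_0_level_sum \<alpha>_def \<beta>_def .
    thus "(if m \<in> {1..} then
        \<Sum>M\<in>fishburn_matrices m. fps_nth (\<Prod>p\<in>M. cell_weight m p) 0 else 0) =
      (if m \<in> {1..} then level_sum \<alpha> (m - 1) \<beta> else 0)" by simp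
  qed
  finally have *: "((\<lambda>(m, M). fps_X ^ m * fps_const (fps_nth (\<Prod>p\<in>M. cell_weight m p) 0))
      has_sum Q) ?S" unfolding Q_def .
  have "((\<lambda>q. class_weight (case q of (m, M) \<Rightarrow> iso_rel `` {cell_order M})) has_sum Q) ?S"
  proof (rule has_sum_cong[THEN iffD1, OF _ *])
    fix q assume "q \<in> ?S"
    then obtain m M where q: "q = (m, M)" and M: "M \<in> fishburn_matrices m" by auto
    have "class_weight (iso_rel `` {cell_order M}) = weight (cell_order M)"
      using cell_order_properties(1)[OF M] by (intro class_weight_eq) (simp add: interval_order_def)
    also have "\<dots> = fps_X ^ m * fps_const (fps_nth (\<Prod>p\<in>M. cell_weight m p) 0)"
      unfolding cell_order_properties(3)[OF M] var_t_def
      by (simp only: prod_cell_weight_const[symmetric])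
    finally show "(case q of (m, M) \<Rightarrow>
        fps_X ^ m * fps_const (fps_nth (\<Prod>p\<in>M. cell_weight m p) 0)) =
      class_weight (case q of (m, M) \<Rightarrow> iso_rel `` {cell_order M})"
      unfolding q by simp
  qed
  hence sum_P: "(class_weight has_sum Q) primitive_interval_orders"
    using has_sum_reindex_bij_betw[OF bij_betw_fishburn_primitive_interval_orders] by blast
  hence P: "P_series = Q" unfolding P_series_def by (rule infsumI)

  define d where "d k = 1 + var_t * V k var_v var_w" for k
  have d: "d k = 1 + fps_X * fps_const (\<alpha> k)" for k
    by (simp add: d_def var_t_def V_\<alpha>)
  have d0: "fps_nth (d k) 0 = 1" for k by (simp add: d)
  have d_nz: "d k \<noteq> 0" for k using d0[of k] by auto
  have div_mult: "a / d k * d k = a" for a k by (rule divide_mult_cancel_unit[OF d0])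
  \<comment> \<open>The coefficients form no field, so passing from a quotient to a product is
    derived by cancelling \<open>d k\<close>.\<close>
  have divide_d: "a / d k = a * (1 / d k)" for a k
  proof (rule mult_right_cancel[THEN iffD1, OF d_nz[of k]])
    show "a / d k * d k = a * (1 / d k) * d k"
      by (simp only: mult.assoc div_mult mult_1_right)
  qed
  \<comment> \<open>Term \<open>n\<close> of the claimed series without one factor
    \<open>var_t\<close> and without \<open>V n var_x var_y\<close>.\<close>
  define c where "c n = fps_X ^ n * (1 / d n) * (\<Prod>i<n. V i var_v var_w / d i)" for n
  have c_0: "c 0 * (1 + fps_X * fps_const (\<alpha> 0)) = 1"
    using div_mult[of 1 0] by (simp add: c_def d[symmetric])
  have c_Suc: "c (Suc n) * (1 + fps_X * fps_const (\<alpha> (Suc n))) =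
      fps_X * (fps_const (\<alpha> n) * c n)" for n
  proof -
    have "c (Suc n) * d (Suc n) = fps_X ^ Suc n * (1 / d (Suc n) * d (Suc n)) *
        ((\<Prod>i<n. V i var_v var_w / d i) * (V n var_v var_w * (1 / d n)))"
      unfolding c_def prod.lessThan_Suc divide_d[of "V n var_v var_w"] by (simp only: mult_ac)
    also have "\<dots> = fps_X * (V n var_v var_w * c n)"
      unfolding div_mult c_def power_Suc by (simp only: mult_ac mult_1_left)
    finally show ?thesis unfolding d V_\<alpha> .
  qed
  have term_eq: "var_t ^ (n + 1) * (V n var_x var_y / d n) * (\<Prod>i<n. V i var_v var_w / d i) =
      fps_X * (fps_const (\<beta> n) * c n)" for n
    unfolding divide_d[of "V n var_x var_y"] c_def var_t_def V_\<beta>[symmetric]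
      Suc_eq_plus1[symmetric] power_Suc
    by (simp only: mult_ac)
  have "(\<lambda>n. fps_X * (fps_const (\<beta> n) * c n)) sums Q"
    unfolding sums_def
  proof (rule tendsto_fpsI)
    fix m
    show "eventually (\<lambda>N. fps_nth (\<Sum>n<N. fps_X * (fps_const (\<beta> n) * c n)) m = fps_nth Q m)
        sequentially"
      using eventually_gt_at_top[of m]
    proof eventually_elim
      case (elim N)
      \<comment> \<open>The remaining factor \<open>var_t\<close> shifts degrees by one: degree
        \<open>0\<close> is zero on both sides, and magnitude \<open>Suc j\<close> is reached after
        \<open>j\<close> steps of the recursion.\<close>
      show ?case
      proof (cases m)
        case 0
        thus ?thesis by (simp add: fps_sum_nth Q_def)
      next
        case (Suc j)
        hence "j < N" using elim by simp
        from level_sum_eq_sum_fps_nth[OF c_0 c_Suc this, of \<beta>] show ?thesis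
          by (simp add: fps_sum_nth Q_def Suc)
      qed
    qed
  qed
  hence "(\<lambda>n. var_t ^ (n + 1) * (V n var_x var_y / (1 + var_t * V n var_v var_w)) *
      (\<Prod>i<n. V i var_v var_w / (1 + var_t * V i var_v var_w))) sums P_series"
    unfolding P term_eq[symmetric] d_def .
  moreover have "class_weight summable_on primitive_interval_orders"
    using sum_P by (rule has_sum_imp_summable)
  ultimately show ?thesis by simp
qed

end
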